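(* Let $P\in(0,1)^{m\times m}$ be an expected payoff matrix and let $M=\sigma^{-1}(P)$ (applied entrywise). If $M\notin \operatorname{im}(\operatorname{grad})$, i.e. $M$ is not a strongly transitive additive comparison matrix, then there exist at least two connected selection matrices $Q_1$ and $Q_2$ such that the final Elo score associated with $(P,Q_1)$ is different from the final Elo score associated with $(P,Q_2)$.
   Context: There are $m\ge 2$ players. $\sigma:\mathbb{R}\to(0,1)$ is a sigmoid function (typically the logistic function $\sigma(x)=1/(1+e^{-x})$), meaning a continuous strictly increasing bijection with $\sigma(x)+\sigma(-x)=1$ for all $x$. An expected payoff matrix is $P\in\mathbb{R}^{m\times m}$ with entries $P_{ij}\in(0,1)$ and $P_{ij}+P_{ji}=1$ for all $i,j$ ($P_{ij}$ is the probability that player $i$ defeats player $j$). A selection matrix is $Q\in[0,1]^{m\times m}$ that is symmetric with $Q_{ii}=0$, $Q_{ij}\ge 0$ and $\sum_{i,j=1}^m Q_{ij}=2$ ($Q_{ij}$ is the probability that the pair $i,j$ is selected to play). $Q$ is connected if the weighted graph on the vertex set $\{1,\dots,m\}$ with weighted adjacency matrix $Q$ (edge $\{i,j\}$ present iff $Q_{ij}>0$) has exactly one (strongly) connected component, comprising all $m$ vertices. The combinatorial gradient $\operatorname{grad}:\mathbb{R}^m\to\mathbb{R}^{m\times m}$ is $\operatorname{grad}(v)_{ij}=v_i-v_j$; a strongly transitive additive comparison matrix (STACM) is an element of its image. The combinatorial divergence $\operatorname{div}:\mathbb{R}^{m\times m}\to\mathbb{R}^m$ is $\operatorname{div}(A)_i=\frac1m\sum_{j=1}^m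 A_{ij}$. $\odot$ is the entrywise (Hadamard) product, and $\sigma$ is applied to matrices entrywise. A final Elo score associated with $(P,Q)$ is a vector $r\in\mathbb{R}^m$ with $\sum_{i=1}^m r_i=0$ satisfying the stability equation $\operatorname{div}(Q\odot P)=\operatorname{div}\big(Q\odot\sigma(\operatorname{grad}(r))\big)$. For connected $Q$ the final Elo score exists and is unique, so "the final Elo score" is well defined. *)

theory Defs
  imports "HOL-Analysis.Analysis"
begin

text \<open>The players are the elements of a finite index type \<open>'n\<close>, so that \<open>m = CARD('n)\<close>.\<close>

definition sigmoid :: "(real \<Rightarrow> real) \<Rightarrow> bool" where
  "sigmoid \<sigma> \<longleftrightarrow>
     continuous_on UNIV \<sigma> \<and> strict_mono \<sigma> \<and> bij_betw \<sigma> UNIV {0<..<1} \<and>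
     (\<forall>x. \<sigma> x + \<sigma> (- x) = 1)"

definition map_matrix_entries :: "(real \<Rightarrow> real) \<Rightarrow> real^'n^'m \<Rightarrow> real^'n^'m" where
  "map_matrix_entries f A = (\<chi> i j. f (A $ i $ j))"

definition hadamard :: "real^'n^'m \<Rightarrow> real^'n^'m \<Rightarrow> real^'n^'m"  (infixl \<open>\<odot>\<close> 70) where
  "A \<odot> B = (\<chi> i j. A $ i $ j * B $ i $ j)"

definition comb_grad :: "real^'n \<Rightarrow> real^'n^'n" where
  "comb_grad v = (\<chi> i j. v $ i - v $ j)"

definition comb_div :: "real^'n^'n \<Rightarrow> real^'n" where
  "comb_div A = (\<chi> i. (1 / real CARD('n)) * (\<Sum>j\<in>UNIV. A $ i $ j))"

definition expected_payoff_matrix :: "real^'n^'n \<Rightarrow> bool" where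
  "expected_payoff_matrix P \<longleftrightarrow>
     (\<forall>i j. P $ i $ j \<in> {0<..<1}) \<and> (\<forall>i j. P $ i $ j + P $ j $ i = 1)"

definition selection_matrix :: "real^'n^'n \<Rightarrow> bool" where
  "selection_matrix Q \<longleftrightarrow>
     (\<forall>i j. Q $ i $ j \<in> {0..1}) \<and> transpose Q = Q \<and> (\<forall>i. Q $ i $ i = 0) \<and>
     (\<Sum>i\<in>UNIV. \<Sum>j\<in>UNIV. Q $ i $ j) = 2"

definition edges :: "real^'n^'n \<Rightarrow> ('n \<times> 'n) set" where
  "edges Q = {(i, j). Q $ i $ j > 0}"

definition strong_components :: "real^'n^'n \<Rightarrow> 'n set set" where
  "strong_components Q =
     UNIV // {(i, j). (i, j) \<in> (edges Q)\<^sup>* \<and> (j, i) \<in> (edges Q)\<^sup>*}"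

definition connected_matrix :: "real^'n^'n \<Rightarrow> bool" where
  "connected_matrix Q \<longleftrightarrow> strong_components Q = {UNIV}"

definition is_final_elo_score ::
    "(real \<Rightarrow> real) \<Rightarrow> real^'n^'n \<Rightarrow> real^'n^'n \<Rightarrow> real^'n \<Rightarrow> bool" where
  "is_final_elo_score \<sigma> P Q r \<longleftrightarrow>
     (\<Sum>i\<in>UNIV. r $ i) = 0 \<and>
     comb_div (Q \<odot> P) = comb_div (Q \<odot> map_matrix_entries \<sigma> (comb_grad r))"

text \<open>Meaningful only where the score exists and is unique, in particular when \<open>\<sigma>\<close> is a
  sigmoid, \<open>P\<close> an expected payoff matrix and \<open>Q\<close> a connected selection matrix.\<close>

definition final_elo_score ::
    "(real \<Rightarrow> real) \<Rightarrow> real^'n^'n \<Rightarrow> real^'n^'n \<Rightarrow> real^'n" where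
  "final_elo_score \<sigma> P Q = (THE r. is_final_elo_score \<sigma> P Q r)"

end

theory Submission
  imports Defs
begin

text \<open>
  Different tree-shaped selection matrices make the score \<open>r\<close> reproduce different entries of \<open>M\<close>,
  namely those along the edges of the tree; already the stars, jointly, reach all entries. In the
  star centred at \<open>k\<close> each leaf \<open>j\<close> plays only against \<open>k\<close>, so its stability equation has a single term and reads
  \<open>P\<^sub>j\<^sub>k = \<sigma> (r\<^sub>j - r\<^sub>k)\<close>, that is \<open>r\<^sub>j - r\<^sub>k = M\<^sub>j\<^sub>k\<close>. The equation of the centre then holds
  automatically, because \<open>P\<^sub>k\<^sub>j = 1 - P\<^sub>j\<^sub>k\<close> and \<open>\<sigma> (-x) = 1 - \<sigma> x\<close>. Hence the final Elo score of
  the star centred at \<open>k\<close> is the \<open>k\<close>-th column of \<open>M\<close>, shifted to have sum zero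
  (lemmas \<open>final_elo_score_star_iff\<close> and \<open>final_elo_score_star\<close>). In particular its existence
  and uniqueness come for free.

  If all \<open>m\<close> stars had one and the same score \<open>r\<close>, then \<open>r\<^sub>j - r\<^sub>k = M\<^sub>j\<^sub>k\<close> would hold for all
  \<open>j\<close> and \<open>k\<close>, so \<open>M\<close> would be the gradient of \<open>r\<close>. Thus two of the stars have different scores
  whenever \<open>M\<close> is not a gradient.
\<close>

lemma comb_div_eq_iff:
  fixes A B :: "real^'n^'n"
  shows "comb_div A = comb_div B \<longleftrightarrow> (\<forall>i. (\<Sum>j\<in>UNIV. A $ i $ j) = (\<Sum>j\<in>UNIV. B $ i $ j))"
  by (simp add: comb_div_def vec_eq_iff)

lemma sigmoid_inj: "sigmoid \<sigma> \<Longrightarrow> inj \<sigma>"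
  by (simp add: sigmoid_def bij_betw_def)

lemma sigmoid_inv:
  assumes "sigmoid \<sigma>" "p \<in> {0<..<1}"
  shows "\<sigma> (inv \<sigma> p) = p"
  using assms by (metis bij_betw_imp_surj_on f_inv_into_f sigmoid_def)

lemma sigmoid_uminus: "sigmoid \<sigma> \<Longrightarrow> \<sigma> (- x) = 1 - \<sigma> x"
  unfolding sigmoid_def by (metis add_diff_cancel_left')

lemma sigmoid_inv_half:
  assumes "sigmoid \<sigma>"
  shows "inv \<sigma> (1 / 2) = 0"
proof -
  have "\<sigma> 0 = 1 / 2"
    using sigmoid_uminus[OF assms, of 0] by simp
  then show ?thesis
    using inv_f_f[OF sigmoid_inj[OF assms], of 0] by metis
qed

definition star_matrix :: "'n \<Rightarrow> real^'n^'n" where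
  "star_matrix k = (\<chi> i j. if (i = k) \<noteq> (j = k) then 1 / (real CARD('n) - 1) else 0)"

lemma sum_star_matrix_row:
  fixes k :: "'n::finite" and f :: "'n \<Rightarrow> real"
  shows "(\<Sum>j\<in>UNIV. star_matrix k $ i $ j * f j) =
    (if i = k then \<Sum>j\<in>UNIV - {k}. f j else f k) / (real CARD('n) - 1)"
proof (cases "i = k")
  case True
  have "(\<Sum>j\<in>UNIV. star_matrix k $ i $ j * f j) =
      (\<Sum>j\<in>UNIV - {k}. star_matrix k $ i $ j * f j)"
    using True by (subst sum.remove[of UNIV k]) (auto simp: star_matrix_def)
  also have "\<dots> = (\<Sum>j\<in>UNIV - {k}. f j / (real CARD('n) - 1))"
    using True by (intro sum.cong) (auto simp: star_matrix_def)
  finally show ?thesis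
    using True by (simp add: sum_divide_distrib)
next
  case False
  have "(\<Sum>j\<in>UNIV. star_matrix k $ i $ j * f j) = star_matrix k $ i $ k * f k"
    using False by (subst sum.remove[of UNIV k]) (auto simp: star_matrix_def)
  then show ?thesis
    using False by (simp add: star_matrix_def)
qed

lemma selection_matrix_star:
  fixes k :: "'n::finite"
  assumes "CARD('n) \<ge> 2"
  shows "selection_matrix (star_matrix k)"
proof -
  let ?c = "real CARD('n) - 1"
  have c: "?c \<ge> 1"
    using assms by linarith
  have card: "real (card (UNIV - {k})) = ?c"
    using assms by (simp add: of_nat_diff card_Diff_singleton)
  have row: "(\<Sum>j\<in>UNIV. star_matrix k $ i $ j) = (if i = k then 1 else 1 / ?c)" for i
    using sum_star_matrix_row[of k i "\<lambda>_. 1"] card c by simp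
  have "(\<Sum>i\<in>UNIV. \<Sum>j\<in>UNIV. star_matrix k $ i $ j) = 1 + (\<Sum>i\<in>UNIV - {k}. 1 / ?c)"
    unfolding row by (subst sum.remove[of UNIV k]) auto
  also have "\<dots> = 2"
    unfolding sum_constant card using c by simp
  finally show ?thesis
    using c by (auto simp: selection_matrix_def star_matrix_def transpose_def vec_eq_iff)
qed

lemma connected_matrix_star:
  fixes k :: "'n::finite"
  assumes "CARD('n) \<ge> 2"
  shows "connected_matrix (star_matrix k)"
proof -
  have edge: "(i, k) \<in> edges (star_matrix k)" "(k, i) \<in> edges (star_matrix k)" if "i \<noteq> k" for i
    using that assms by (auto simp: edges_def star_matrix_def)
  have "(i, j) \<in> (edges (star_matrix k))\<^sup>*" for i j
  proof (rule rtrancl_trans)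
    show "(i, k) \<in> (edges (star_matrix k))\<^sup>*"
      using edge(1)[of i] by (cases "i = k") auto
    show "(k, j) \<in> (edges (star_matrix k))\<^sup>*"
      using edge(2)[of j] by (cases "j = k") auto
  qed
  then show ?thesis
    by (auto simp: connected_matrix_def strong_components_def quotient_def)
qed

lemma expected_payoff_inv_diag:
  fixes P :: "real^'n^'n"
  assumes "sigmoid \<sigma>" "expected_payoff_matrix P"
  shows "inv \<sigma> (P $ k $ k) = 0"
proof -
  have "P $ k $ k + P $ k $ k = 1"
    using assms(2) by (simp add: expected_payoff_matrix_def)
  then have "P $ k $ k = 1 / 2"
    by linarith
  then show ?thesis
    using sigmoid_inv_half[OF assms(1)] by metis
qed

text \<open>The leaves determine every difference to the centre, and the symmetry of \<open>\<sigma>\<close> turns the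
  equation of the centre into the sum of the equations of the leaves.\<close>

lemma final_elo_score_star_iff:
  fixes P :: "real^'n^'n"
  assumes m: "CARD('n) \<ge> 2" and sig: "sigmoid \<sigma>" and P: "expected_payoff_matrix P"
  shows "is_final_elo_score \<sigma> P (star_matrix k) r \<longleftrightarrow>
    (\<Sum>i\<in>UNIV. r $ i) = 0 \<and> (\<forall>j. r $ j - r $ k = inv \<sigma> (P $ j $ k))"
proof -
  have c: "real CARD('n) - 1 \<noteq> 0"
    using m by linarith
  have win: "\<sigma> (r $ j - r $ k) = P $ j $ k \<longleftrightarrow> r $ j - r $ k = inv \<sigma> (P $ j $ k)" for j
    using sigmoid_inv[OF sig, of "P $ j $ k"] inv_f_f[OF sigmoid_inj[OF sig]] P
    unfolding expected_payoff_matrix_def by metis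
  have "comb_div (star_matrix k \<odot> P) =
      comb_div (star_matrix k \<odot> map_matrix_entries \<sigma> (comb_grad r)) \<longleftrightarrow>
    (\<forall>i. (if i = k then \<Sum>j\<in>UNIV - {k}. P $ i $ j else P $ i $ k) =
      (if i = k then \<Sum>j\<in>UNIV - {k}. \<sigma> (r $ i - r $ j) else \<sigma> (r $ i - r $ k)))"
    using c by (simp add: comb_div_eq_iff hadamard_def map_matrix_entries_def comb_grad_def
      sum_star_matrix_row)
  also have "\<dots> \<longleftrightarrow> (\<forall>j. j \<noteq> k \<longrightarrow> P $ j $ k = \<sigma> (r $ j - r $ k))"
  proof
    assume leaves: "\<forall>j. j \<noteq> k \<longrightarrow> P $ j $ k = \<sigma> (r $ j - r $ k)"
    have "P $ k $ j = \<sigma> (r $ k - r $ j)" if "j \<noteq> k" for j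
    proof -
      have "P $ k $ j + P $ j $ k = 1"
        using P by (simp add: expected_payoff_matrix_def)
      then have "P $ k $ j = 1 - \<sigma> (r $ j - r $ k)"
        using leaves that by force
      then show ?thesis
        using sigmoid_uminus[OF sig, of "r $ j - r $ k"] by simp
    qed
    then have "(\<Sum>j\<in>UNIV - {k}. P $ k $ j) = (\<Sum>j\<in>UNIV - {k}. \<sigma> (r $ k - r $ j))"
      by (intro sum.cong) auto
    then show "\<forall>i. (if i = k then \<Sum>j\<in>UNIV - {k}. P $ i $ j else P $ i $ k) =
      (if i = k then \<Sum>j\<in>UNIV - {k}. \<sigma> (r $ i - r $ j) else \<sigma> (r $ i - r $ k))"
      using leaves by auto
  qed metis
  also have "\<dots> \<longleftrightarrow> (\<forall>j. r $ j - r $ k = inv \<sigma> (P $ j $ k))"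
    \<comment> \<open>For \<open>j = k\<close> the right-hand side says \<open>0 = 0\<close>.\<close>
    using win expected_payoff_inv_diag[OF sig P, of k] by (metis diff_self)
  finally show ?thesis
    by (simp add: is_final_elo_score_def)
qed

text \<open>The centred \<open>k\<close>-th column of \<open>\<sigma>\<^sup>-\<^sup>1(P)\<close> is the only score for the star at \<open>k\<close>, so the definite
  description in the definition of the final Elo score denotes it.\<close>

lemma final_elo_score_star:
  fixes P :: "real^'n^'n"
  assumes m: "CARD('n) \<ge> 2" and sig: "sigmoid \<sigma>" and P: "expected_payoff_matrix P"
  shows "final_elo_score \<sigma> P (star_matrix k) =
    (\<chi> j. inv \<sigma> (P $ j $ k) - (\<Sum>i\<in>UNIV. inv \<sigma> (P $ i $ k)) / real CARD('n))"
    (is "_ = ?r")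
  unfolding final_elo_score_def final_elo_score_star_iff[OF assms]
proof (rule the_equality)
  show "(\<Sum>i\<in>UNIV. ?r $ i) = 0 \<and> (\<forall>j. ?r $ j - ?r $ k = inv \<sigma> (P $ j $ k))"
    by (simp add: sum_subtractf expected_payoff_inv_diag[OF sig P])
next
  fix s :: "real^'n"
  assume s: "(\<Sum>i\<in>UNIV. s $ i) = 0 \<and> (\<forall>j. s $ j - s $ k = inv \<sigma> (P $ j $ k))"
  then have sum0: "(\<Sum>i\<in>UNIV. s $ i) = 0" and col: "inv \<sigma> (P $ j $ k) = s $ j - s $ k" for j
    by auto
  show "s = ?r"
    by (simp only: col) (use sum0 in \<open>simp add: vec_eq_iff sum_subtractf\<close>)
qed

theorem theorem4p1:
  fixes \<sigma> :: "real \<Rightarrow> real" and P M :: "real^'n^'n"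
  assumes "CARD('n) \<ge> 2"
    and "sigmoid \<sigma>"
    and "expected_payoff_matrix P"
    and "M = map_matrix_entries (inv \<sigma>) P"
    and "M \<notin> range comb_grad"
  shows "\<exists>Q1 Q2 :: real^'n^'n.
           selection_matrix Q1 \<and> connected_matrix Q1 \<and>
           selection_matrix Q2 \<and> connected_matrix Q2 \<and>
           final_elo_score \<sigma> P Q1 \<noteq> final_elo_score \<sigma> P Q2"
proof -
  let ?elo = "\<lambda>k. final_elo_score \<sigma> P (star_matrix k)"
  have diff: "?elo k $ j - ?elo k $ k = M $ j $ k" for j k
    unfolding final_elo_score_star[OF assms(1-3)] assms(4)
    by (simp add: map_matrix_entries_def expected_payoff_inv_diag[OF assms(2,3)])
  have "\<exists>k l. ?elo k \<noteq> ?elo l"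
  proof (rule ccontr)
    assume "\<not> ?thesis"
    then obtain r where "?elo k = r" for k
      by metis
    then have "M = comb_grad r"
      using diff by (simp add: comb_grad_def vec_eq_iff)
    then show False
      using assms(5) by blast
  qed
  then show ?thesis
    using selection_matrix_star[OF assms(1)] connected_matrix_star[OF assms(1)] by blast
qed

end
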